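(* Let $G$ be a finite group, let $P(g)=\frac{r(g)}{|G|}$ for $g\in G$, where $r(g)=|\{h\in G : h^2=g\}|$, let $P^{(n)}$ be the $n$-fold convolution of $P$, and let $U(g)=\frac{1}{|G|}$ be the uniform probability on $G$. Let $R_1(G)$ be the set of all real-valued non-principal linear (degree one) complex characters of $G$. Then $\|P^{(n)}-U\|\to 0$ as $n\to\infty$ if and only if $R_1(G)=\varnothing$.
   Context: The convolution of two functions $P,Q$ on $G$ is $(P*Q)(h)=\sum_{g\in G}P(g)Q(g^{-1}h)$, $h\in G$, and $P^{(n)}=P*\cdots*P$ ($n$ factors). The norm $\|\cdot\|$ is the one induced by the scalar product $(F_1,F_2)=\frac{1}{|G|}\sum_{g\in G}F_1(g)\overline{F_2(g)}$ on complex functions on $G$. A character is called real if all its values are real numbers. The principal character is the constant function $\mathbf{1}_G$. *)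

theory Defs
  imports Complex_Main "HOL-Algebra.Group" "Jordan_Normal_Form.Matrix"
begin

section \<open>Complex-valued functions on a finite group\<close>

text \<open>
  Functions on a group \<open>G\<close> are HOL functions on the element type of which only the values on
  the carrier matter.  The probabilities \<open>P\<close> and \<open>U\<close> are taken complex-valued, since they live
  in the inner product space of complex functions on \<open>G\<close>.
\<close>

definition convolution ::
    "('a, 'b) monoid_scheme \<Rightarrow> ('a \<Rightarrow> complex) \<Rightarrow> ('a \<Rightarrow> complex) \<Rightarrow> 'a \<Rightarrow> complex" where
  "convolution G P Q h = (\<Sum>g\<in>carrier G. P g * Q (inv\<^bsub>G\<^esub> g \<otimes>\<^bsub>G\<^esub> h))"

text \<open>The index \<open>0\<close> is a junk case (the power has \<open>n \<ge> 1\<close> factors), irrelevant for limits.\<close>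

fun conv_power ::
    "('a, 'b) monoid_scheme \<Rightarrow> ('a \<Rightarrow> complex) \<Rightarrow> nat \<Rightarrow> 'a \<Rightarrow> complex" where
  "conv_power G P 0 = (\<lambda>_. 0)"
| "conv_power G P (Suc 0) = P"
| "conv_power G P (Suc (Suc n)) = convolution G P (conv_power G P (Suc n))"

definition scalar_product ::
    "('a, 'b) monoid_scheme \<Rightarrow> ('a \<Rightarrow> complex) \<Rightarrow> ('a \<Rightarrow> complex) \<Rightarrow> complex" where
  "scalar_product G F1 F2 =
     1 / of_nat (card (carrier G)) * (\<Sum>g\<in>carrier G. F1 g * cnj (F2 g))"

text \<open>\<open>scalar_product G F F\<close> is a nonnegative real number, so \<open>Re\<close> only changes its type.\<close>

definition function_norm :: "('a, 'b) monoid_scheme \<Rightarrow> ('a \<Rightarrow> complex) \<Rightarrow> real" where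
  "function_norm G F = sqrt (Re (scalar_product G F F))"

definition root_count :: "('a, 'b) monoid_scheme \<Rightarrow> 'a \<Rightarrow> nat" where
  "root_count G g = card {h \<in> carrier G. h [^]\<^bsub>G\<^esub> (2::nat) = g}"

definition square_prob :: "('a, 'b) monoid_scheme \<Rightarrow> 'a \<Rightarrow> complex" where
  "square_prob G g = of_nat (root_count G g) / of_nat (card (carrier G))"

definition uniform_prob :: "('a, 'b) monoid_scheme \<Rightarrow> 'a \<Rightarrow> complex" where
  "uniform_prob G g = 1 / of_nat (card (carrier G))"


section \<open>Complex characters\<close>

definition general_linear_group :: "nat \<Rightarrow> complex mat monoid" where
  "general_linear_group n = units_of (ring_mat TYPE(complex) n ())"

definition matrix_trace :: "complex mat \<Rightarrow> complex" where
  "matrix_trace A = (\<Sum>i<dim_row A. A $$ (i, i))"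

text \<open>
  Characters are extensional (\<open>undefined\<close> off the carrier), so that equal functions on the
  group are equal as HOL functions.
\<close>

definition character_of_degree ::
    "('a, 'b) monoid_scheme \<Rightarrow> nat \<Rightarrow> ('a \<Rightarrow> complex) \<Rightarrow> bool" where
  "character_of_degree G n \<chi> \<longleftrightarrow>
     n > 0 \<and> (\<exists>\<rho> \<in> hom G (general_linear_group n). \<chi> = (\<lambda>g\<in>carrier G. matrix_trace (\<rho> g)))"

definition linear_character :: "('a, 'b) monoid_scheme \<Rightarrow> ('a \<Rightarrow> complex) \<Rightarrow> bool" where
  "linear_character G \<chi> \<longleftrightarrow> character_of_degree G 1 \<chi>"

definition real_character :: "('a, 'b) monoid_scheme \<Rightarrow> ('a \<Rightarrow> complex) \<Rightarrow> bool" where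
  "real_character G \<chi> \<longleftrightarrow> (\<forall>g\<in>carrier G. \<chi> g \<in> \<real>)"

definition principal_character :: "('a, 'b) monoid_scheme \<Rightarrow> 'a \<Rightarrow> complex" where
  "principal_character G = (\<lambda>g\<in>carrier G. 1)"

definition R1 :: "('a, 'b) monoid_scheme \<Rightarrow> ('a \<Rightarrow> complex) set" where
  "R1 G = {\<chi>. linear_character G \<chi> \<and> real_character G \<chi> \<and> \<chi> \<noteq> principal_character G}"

end

theory Submission
  imports Defs "HOL-Library.Complex_Order" "HOL-Algebra.Multiplicative_Group"
    "HOL-Algebra.Generated_Groups"
begin

text \<open>
  If \<open>\<chi>\<close> is a real linear character, then \<open>\<chi>(h\<^sup>2) = 1\<close>, so \<open>\<Sum>\<^sub>g \<chi>(g) P\<^sup>(\<^sup>n\<^sup>)(g) = 1\<close> for all \<open>n\<close>,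
  while \<open>\<Sum>\<^sub>g \<chi>(g) U(g) = 0\<close> unless \<open>\<chi>\<close> is principal.  Conversely, if there is no such nonprincipal
  \<open>\<chi>\<close>, then \<open>G\<close> has no subgroup of index two, hence is generated by its squares.  As \<open>P(1) > 0\<close>,
  some power \<open>P\<^sup>(\<^sup>m\<^sup>)\<close> is then positive on all of \<open>G\<close>, and convolution with it is a strict
  \<open>\<ell>\<^sup>1\<close>-contraction on functions of sum zero.
\<close>

section \<open>Linear characters as multiplicative functions, and the norm as a sum of
  squares\<close>

text \<open>1 by 1 matrices multiply like their entries, and \<open>inverse (\<chi> g)\<close>
  supplies the inverse matrix. This spares the sign character of an index-two subgroup any further
  matrix work.\<close>

lemma linear_characterI:
  assumes "\<And>g. g \<in> carrier G \<Longrightarrow> \<chi> g \<noteq> 0"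
    and "\<And>g h. g \<in> carrier G \<Longrightarrow> h \<in> carrier G \<Longrightarrow> \<chi> (g \<otimes>\<^bsub>G\<^esub> h) = \<chi> g * \<chi> h"
  shows "linear_character G (\<lambda>g\<in>carrier G. \<chi> g)"
proof -
  define \<rho> where "\<rho> g = mat 1 1 (\<lambda>_. \<chi> g)" for g
  have mult: "mat 1 1 (\<lambda>_. a) * mat 1 1 (\<lambda>_. b) = mat 1 1 (\<lambda>_. a * b)" for a b :: complex
    by (rule eq_matI) (auto simp: scalar_prod_def)
  have one: "mat 1 1 (\<lambda>_. 1) = (1\<^sub>m 1 :: complex mat)"
    by (rule eq_matI) auto
  have "\<rho> g \<in> Units (ring_mat TYPE(complex) 1 ())" if "g \<in> carrier G" for g
  proof -
    have "mat 1 1 (\<lambda>_. inverse (\<chi> g)) * \<rho> g = 1\<^sub>m 1" "\<rho> g * mat 1 1 (\<lambda>_. inverse (\<chi> g)) = 1\<^sub>m 1"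
      using assms(1)[OF that] by (simp_all only: \<rho>_def mult one[symmetric]) simp_all
    then show ?thesis
      unfolding Units_def ring_mat_simps
      by (auto simp: \<rho>_def intro!: bexI[of _ "mat 1 1 (\<lambda>_. inverse (\<chi> g))"])
  qed
  then have "\<rho> \<in> hom G (general_linear_group 1)"
    unfolding hom_def general_linear_group_def units_of_def
    by (auto simp: ring_mat_simps assms(2) \<rho>_def mult[simplified])
  moreover have "matrix_trace (\<rho> g) = \<chi> g" for g
    by (simp add: matrix_trace_def \<rho>_def)
  ultimately show ?thesis
    unfolding linear_character_def character_of_degree_def
    by (intro conjI bexI[of _ \<rho>]) auto
qed

lemma linear_character_mult:
  assumes "linear_character G \<chi>" and "monoid G" and "g \<in> carrier G" "h \<in> carrier G"
  shows "\<chi> (g \<otimes>\<^bsub>G\<^esub> h) = \<chi> g * \<chi> h"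
proof -
  obtain \<rho> where \<rho>: "\<rho> \<in> hom G (general_linear_group 1)"
    and \<chi>: "\<chi> = (\<lambda>g\<in>carrier G. matrix_trace (\<rho> g))"
    using assms(1) unfolding linear_character_def character_of_degree_def by blast
  have dim: "\<rho> x \<in> carrier_mat 1 1" if "x \<in> carrier G" for x
    using \<rho> that unfolding hom_def general_linear_group_def units_of_def Units_def
    by (auto simp: ring_mat_simps)
  have "\<rho> (g \<otimes>\<^bsub>G\<^esub> h) = \<rho> g * \<rho> h"
    using hom_mult[OF \<rho> assms(3,4)]
    by (simp add: general_linear_group_def units_of_def ring_mat_simps)
  then show ?thesis
    using dim[OF assms(3)] dim[OF assms(4)] monoid.m_closed[OF assms(2-4)] assms(3,4)
    by (simp add: \<chi> matrix_trace_def scalar_prod_def)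
qed

lemma linear_character_nonzero:
  assumes "linear_character G \<chi>" and "group G" and "g \<in> carrier G"
  shows "\<chi> g \<noteq> 0"
proof
  interpret group G by fact
  assume zero: "\<chi> g = 0"
  obtain \<rho> where \<rho>: "\<rho> \<in> hom G (general_linear_group 1)"
    and \<chi>: "\<chi> = (\<lambda>g\<in>carrier G. matrix_trace (\<rho> g))"
    using assms(1) unfolding linear_character_def character_of_degree_def by blast
  have "\<rho> g \<in> Units (ring_mat TYPE(complex) 1 ())"
    using \<rho> assms(3) unfolding hom_def general_linear_group_def units_of_def by auto
  then obtain B where B: "\<rho> g \<in> carrier_mat 1 1" "B \<in> carrier_mat 1 1" "\<rho> g * B = 1\<^sub>m 1"
    unfolding Units_def ring_mat_simps by auto
  have "\<rho> g $$ (0,0) = 0"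
    using zero B(1) assms(3) by (simp add: \<chi> matrix_trace_def)
  then have "(\<rho> g * B) $$ (0,0) = 0"
    using B(1,2) by (simp add: scalar_prod_def)
  with B(3) show False by simp
qed

lemma function_norm_eq:
  "function_norm G F = sqrt ((\<Sum>g\<in>carrier G. (cmod (F g))\<^sup>2) / card (carrier G))"
proof -
  have "scalar_product G F F = of_real ((\<Sum>g\<in>carrier G. (cmod (F g))\<^sup>2) / card (carrier G))"
    unfolding scalar_product_def by (simp add: complex_norm_square[symmetric] del: of_real_power)
  then show ?thesis
    unfolding function_norm_def by (simp only: Re_complex_of_real)
qed

section \<open>Translation invariance and convolution\<close>

context group
begin

lemma sum_translate:
  assumes "x \<in> carrier G"
  shows "(\<Sum>g\<in>carrier G. f (x \<otimes> g)) = (\<Sum>g\<in>carrier G. f g)"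
  using sum.reindex[OF inj_on_cmult[OF assms], of f] surj_const_mult[OF assms]
  by (simp add: o_def)

lemma sum_translate_inv:
  assumes "h \<in> carrier G"
  shows "(\<Sum>g\<in>carrier G. f (inv g \<otimes> h)) = (\<Sum>g\<in>carrier G. f g)"
  by (rule sum.reindex_bij_witness[of _ "\<lambda>k. h \<otimes> inv k" "\<lambda>g. inv g \<otimes> h"])
    (use assms in \<open>auto simp: inv_mult_group m_assoc[symmetric], simp_all add: m_assoc\<close>)

lemma convolution_cong:
  assumes "\<And>g. g \<in> carrier G \<Longrightarrow> A g = A' g" "\<And>g. g \<in> carrier G \<Longrightarrow> B g = B' g"
    and "h \<in> carrier G"
  shows "convolution G A B h = convolution G A' B' h"
  unfolding convolution_def using assms by (intro sum.cong) auto

text \<open>Substituting \<open>inv g \<otimes> u\<close> for the inner variable turns the argument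
  of \<open>C\<close> into \<open>inv u \<otimes> h\<close>, which is free of \<open>g\<close>; the
  two sums can then be interchanged.\<close>

lemma convolution_assoc:
  assumes h: "h \<in> carrier G"
  shows "convolution G A (convolution G B C) h = convolution G (convolution G A B) C h"
proof -
  have inner: "(\<Sum>k\<in>carrier G. B k * C (inv k \<otimes> (inv g \<otimes> h))) =
      (\<Sum>u\<in>carrier G. B (inv g \<otimes> u) * C (inv u \<otimes> h))" if g: "g \<in> carrier G" for g
  proof -
    have "(\<Sum>k\<in>carrier G. B k * C (inv k \<otimes> (inv g \<otimes> h))) =
        (\<Sum>u\<in>carrier G. B (inv g \<otimes> u) * C (inv (inv g \<otimes> u) \<otimes> (inv g \<otimes> h)))"
      using sum_translate[of "inv g" "\<lambda>k. B k * C (inv k \<otimes> (inv g \<otimes> h))"] g by simp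
    also have "\<dots> = (\<Sum>u\<in>carrier G. B (inv g \<otimes> u) * C (inv u \<otimes> h))"
    proof (intro sum.cong refl)
      fix u assume u: "u \<in> carrier G"
      have "inv (inv g \<otimes> u) \<otimes> (inv g \<otimes> h) = inv u \<otimes> (g \<otimes> (inv g \<otimes> h))"
        using g h u by (simp add: inv_mult_group m_assoc)
      also have "g \<otimes> (inv g \<otimes> h) = h"
        using g h by (simp add: m_assoc[symmetric])
      finally show "B (inv g \<otimes> u) * C (inv (inv g \<otimes> u) \<otimes> (inv g \<otimes> h)) =
        B (inv g \<otimes> u) * C (inv u \<otimes> h)" by simp
    qed
    finally show ?thesis .
  qed
  have "convolution G A (convolution G B C) h =
      (\<Sum>g\<in>carrier G. \<Sum>u\<in>carrier G. A g * B (inv g \<otimes> u) * C (inv u \<otimes> h))"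
    unfolding convolution_def
    by (intro sum.cong refl) (simp add: inner sum_distrib_left mult.assoc)
  also have "\<dots> = (\<Sum>u\<in>carrier G. \<Sum>g\<in>carrier G. A g * B (inv g \<otimes> u) * C (inv u \<otimes> h))"
    by (rule sum.swap)
  also have "\<dots> = convolution G (convolution G A B) C h"
    unfolding convolution_def by (simp add: sum_distrib_right)
  finally show ?thesis .
qed

text \<open>The recursion adds a single factor \<open>P\<close> on the left, so associativity is
  what splits a power at an arbitrary place. Writing both exponents as successors keeps clear of the
  junk value at 0.\<close>

lemma conv_power_add:
  assumes "h \<in> carrier G"
  shows "conv_power G P (Suc m + Suc n) h =
    convolution G (conv_power G P (Suc m)) (conv_power G P (Suc n)) h"
  using assms
proof (induction m arbitrary: h)
  case 0
  then show ?case by simp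
next
  case (Suc m)
  have "conv_power G P (Suc (Suc m) + Suc n) h =
      convolution G P (conv_power G P (Suc m + Suc n)) h"
    by simp
  also have "\<dots> = convolution G P
      (convolution G (conv_power G P (Suc m)) (conv_power G P (Suc n))) h"
    using Suc by (intro convolution_cong) auto
  finally show ?case
    using Suc.prems by (simp add: convolution_assoc)
qed

section \<open>Sums against multiplicative functions\<close>

text \<open>The substitution \<open>h = g \<otimes> k\<close> separates the double sum: this is the
  Fourier transform at a one-dimensional representation. Assuming just multiplicativity of
  \<open>\<chi>\<close> admits the constant 1, for which the sums are total masses.\<close>

lemma sum_character_convolution:
  assumes "\<And>g h. g \<in> carrier G \<Longrightarrow> h \<in> carrier G \<Longrightarrow> \<chi> (g \<otimes> h) = \<chi> g * \<chi> h"
  shows "(\<Sum>h\<in>carrier G. \<chi> h * convolution G A B h) =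
    (\<Sum>g\<in>carrier G. \<chi> g * A g) * (\<Sum>g\<in>carrier G. \<chi> g * B g)"
proof -
  have "(\<Sum>h\<in>carrier G. \<chi> h * convolution G A B h) =
      (\<Sum>g\<in>carrier G. \<Sum>h\<in>carrier G. \<chi> h * (A g * B (inv g \<otimes> h)))"
    unfolding convolution_def sum_distrib_left by (rule sum.swap)
  also have "\<dots> = (\<Sum>g\<in>carrier G. \<Sum>k\<in>carrier G. (\<chi> g * A g) * (\<chi> k * B k))"
  proof (rule sum.cong[OF refl])
    fix g assume g: "g \<in> carrier G"
    have "(\<Sum>h\<in>carrier G. \<chi> h * (A g * B (inv g \<otimes> h))) =
        (\<Sum>k\<in>carrier G. \<chi> (g \<otimes> k) * (A g * B (inv g \<otimes> (g \<otimes> k))))"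
      by (rule sum_translate[OF g, symmetric])
    also have "\<dots> = (\<Sum>k\<in>carrier G. (\<chi> g * A g) * (\<chi> k * B k))"
      using g assms by (intro sum.cong) (auto simp: m_assoc[symmetric])
    finally show "(\<Sum>h\<in>carrier G. \<chi> h * (A g * B (inv g \<otimes> h))) =
      (\<Sum>k\<in>carrier G. (\<chi> g * A g) * (\<chi> k * B k))" .
  qed
  finally show ?thesis
    by (simp add: sum_product)
qed

lemma sum_character_conv_power:
  assumes "\<And>g h. g \<in> carrier G \<Longrightarrow> h \<in> carrier G \<Longrightarrow> \<chi> (g \<otimes> h) = \<chi> g * \<chi> h"
  shows "(\<Sum>h\<in>carrier G. \<chi> h * conv_power G P (Suc n) h) = (\<Sum>g\<in>carrier G. \<chi> g * P g) ^ Suc n"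
  using sum_character_convolution[of \<chi>, OF assms] by (induction n) simp_all

text \<open>Sort the elements \<open>h\<close> by their square: on the fibre over \<open>g\<close>,
  \<open>(\<chi> h)\<^sup>2\<close> has the constant value \<open>\<chi> g\<close>, and the fibre
  has \<open>root_count G g\<close> elements.\<close>

lemma sum_character_square_prob:
  assumes "finite (carrier G)"
    and "\<And>g h. g \<in> carrier G \<Longrightarrow> h \<in> carrier G \<Longrightarrow> \<chi> (g \<otimes> h) = \<chi> g * \<chi> h"
  shows "(\<Sum>g\<in>carrier G. \<chi> g * square_prob G g) =
    (\<Sum>h\<in>carrier G. (\<chi> h)\<^sup>2) / of_nat (card (carrier G))"
proof -
  have "(\<Sum>g\<in>carrier G. \<chi> g * of_nat (root_count G g)) =
      (\<Sum>g\<in>carrier G. \<Sum>h | h \<in> carrier G \<and> h [^] (2::nat) = g. (\<chi> h)\<^sup>2)"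
  proof (intro sum.cong refl)
    fix g
    have "(\<Sum>h | h \<in> carrier G \<and> h [^] (2::nat) = g. (\<chi> h)\<^sup>2) =
        (\<Sum>h | h \<in> carrier G \<and> h [^] (2::nat) = g. \<chi> g)"
      by (intro sum.cong) (auto simp: assms(2) numeral_2_eq_2)
    then show "\<chi> g * of_nat (root_count G g) =
        (\<Sum>h | h \<in> carrier G \<and> h [^] (2::nat) = g. (\<chi> h)\<^sup>2)"
      by (simp add: root_count_def)
  qed
  also have "\<dots> = (\<Sum>h\<in>carrier G. (\<chi> h)\<^sup>2)"
    using sum.group[OF assms(1) assms(1), of "\<lambda>h. h [^] (2::nat)" "\<lambda>h. (\<chi> h)\<^sup>2"] by auto
  finally show ?thesis
    by (simp add: square_prob_def sum_divide_distrib[symmetric])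
qed

text \<open>Translation by \<open>x\<close> permutes the summands but multiplies the sum by
  \<open>\<chi> x\<close>, which differs from 1.\<close>

lemma character_sum_zero:
  fixes \<chi> :: "'a \<Rightarrow> complex"
  assumes "\<And>g h. g \<in> carrier G \<Longrightarrow> h \<in> carrier G \<Longrightarrow> \<chi> (g \<otimes> h) = \<chi> g * \<chi> h"
    and "x \<in> carrier G" "\<chi> x \<noteq> 1"
  shows "(\<Sum>g\<in>carrier G. \<chi> g) = 0"
proof -
  have "(\<Sum>g\<in>carrier G. \<chi> g) = (\<Sum>g\<in>carrier G. \<chi> (x \<otimes> g))"
    by (rule sum_translate[OF assms(2), symmetric])
  also have "\<dots> = \<chi> x * (\<Sum>g\<in>carrier G. \<chi> g)"
    by (simp add: assms(1,2) sum_distrib_left)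
  finally show ?thesis
    using assms(3) by (metis mult_cancel_right1)
qed

section \<open>Real linear characters and subgroups of index two\<close>

text \<open>By Lagrange the value \<open>\<chi> x\<close> is a root of unity, hence of modulus 1; a
  real number of modulus 1 is 1 or -1.\<close>

lemma real_linear_character_square:
  assumes fin: "finite (carrier G)" and lin: "linear_character G \<chi>" and "real_character G \<chi>"
    and x: "x \<in> carrier G"
  shows "(\<chi> x)\<^sup>2 = 1"
proof -
  have one: "\<chi> \<one> = 1"
    using linear_character_mult[OF lin is_monoid one_closed one_closed]
      linear_character_nonzero[OF lin is_group one_closed] by simp
  have pow: "\<chi> (x [^] (n::nat)) = \<chi> x ^ n" for n
    by (induction n) (simp_all add: one linear_character_mult[OF lin is_monoid] x)
  have "\<chi> x ^ order G = 1"
    using pow[of "order G"] pow_order_eq_1[OF x] one by simp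
  then have "cmod (\<chi> x) ^ order G = 1"
    by (metis norm_one norm_power)
  moreover have "order G > 0"
    using order_gt_0_iff_finite fin by blast
  ultimately have "cmod (\<chi> x) = 1"
    by (metis norm_ge_zero power_eq_1_iff norm_power power_one_right real_norm_def abs_norm_cancel neq0_conv)
  moreover obtain r where "\<chi> x = of_real r"
    using assms(3) x unfolding real_character_def by (auto elim: Reals_cases)
  ultimately show ?thesis
    by (simp add: abs_square_eq_1 power2_eq_1_iff flip: of_real_power)
qed

text \<open>An index-two subgroup arises as a maximal proper subgroup \<open>M\<close> containing all squares: for
  \<open>x \<notin> M\<close> the identity \<open>x m x = (x m)\<^sup>2 m\<^sup>-\<^sup>1\<close> makes \<open>M \<union> x M\<close> a subgroup, hence all of \<open>G\<close>.\<close>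

lemma R1_nonempty:
  assumes fin: "finite (carrier G)"
    and "generate G ((\<lambda>h. h \<otimes> h) ` carrier G) \<noteq> carrier G" (is "?N \<noteq> _")
  shows "R1 G \<noteq> {}"
proof -
  define S where "S = {H. subgroup H G \<and> (\<lambda>h. h \<otimes> h) ` carrier G \<subseteq> H \<and> H \<noteq> carrier G}"
  have "finite S"
    by (rule finite_subset[of _ "Pow (carrier G)"]) (auto simp: S_def fin dest: subgroup.subset)
  moreover have "?N \<in> S"
    using assms(2) by (auto simp: S_def intro: generate.incl intro!: generate_is_subgroup)
  ultimately obtain M where M: "M \<in> S" and max: "\<And>H. H \<in> S \<Longrightarrow> M \<subseteq> H \<Longrightarrow> M = H"
    using finite_has_maximal[of S] by blast
  interpret M: subgroup M G using M by (simp add: S_def)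
  have sq: "h \<otimes> h \<in> M" if "h \<in> carrier G" for h
    using M that by (auto simp: S_def)
  have conj: "x \<otimes> m \<otimes> x \<in> M" if x: "x \<in> carrier G" and m: "m \<in> M" for x m
  proof -
    have mc: "m \<in> carrier G" using m by simp
    have "(x \<otimes> m) \<otimes> (x \<otimes> m) \<otimes> inv m = x \<otimes> m \<otimes> x"
      using x mc by (simp add: m_assoc)
    moreover have "(x \<otimes> m) \<otimes> (x \<otimes> m) \<otimes> inv m \<in> M"
      using sq[of "x \<otimes> m"] x mc m by blast
    ultimately show ?thesis by simp
  qed
  have cover: "\<exists>m\<in>M. h = x \<otimes> m"
    if x: "x \<in> carrier G" "x \<notin> M" and h: "h \<in> carrier G" "h \<notin> M" for x h
  proof -
    define K where "K = M \<union> (\<lambda>m. x \<otimes> m) ` M"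
    \<comment> \<open>Moves \<open>a\<close> past \<open>x\<close> without knowing that
      \<open>M\<close> is normal: the compensating factor
      \<open>inv (x \<otimes> x) \<otimes> (x \<otimes> a \<otimes> x)\<close> lies in
      \<open>M\<close> by \<open>sq\<close> and \<open>conj\<close>.\<close>
    have M_mult_coset: "a \<in> M \<Longrightarrow> b \<in> M \<Longrightarrow> a \<otimes> (x \<otimes> b) \<in> (\<lambda>m. x \<otimes> m) ` M" for a b
    proof -
      assume a: "a \<in> M" and b: "b \<in> M"
      have ac: "a \<in> carrier G" "b \<in> carrier G" using a b by auto
      have "x \<otimes> (inv (x \<otimes> x) \<otimes> (x \<otimes> a \<otimes> x) \<otimes> b) = a \<otimes> (x \<otimes> b)"
      proof -
        have "x \<otimes> (inv (x \<otimes> x) \<otimes> (x \<otimes> a \<otimes> x) \<otimes> b) =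
          (x \<otimes> inv x) \<otimes> ((inv x \<otimes> x) \<otimes> (a \<otimes> (x \<otimes> b)))"
          using x ac by (simp only: m_assoc inv_mult_group m_closed inv_closed)
        then show ?thesis using x ac by simp
      qed
      moreover have "inv (x \<otimes> x) \<otimes> (x \<otimes> a \<otimes> x) \<otimes> b \<in> M"
        using sq[of x] conj[of x a] x a b by blast
      ultimately show ?thesis by (metis imageI)
    qed
    have "subgroup K G"
    proof (rule subgroupI)
      show "K \<subseteq> carrier G" using x by (auto simp: K_def)
      show "K \<noteq> {}" using M.one_closed unfolding K_def by blast
    next
      fix a assume "a \<in> K"
      then consider "a \<in> M" | b where "b \<in> M" "a = x \<otimes> b" by (auto simp: K_def)
      then show "inv a \<in> K"
      proof cases
        case 1
        then show ?thesis by (simp add: K_def)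
      next
        case 2
        have bc: "b \<in> carrier G" using 2 by simp
        \<comment> \<open>Writing \<open>inv x\<close> as \<open>x\<close> times the inverse of a
          square puts \<open>inv a\<close> into the form handled by
          \<open>M_mult_coset\<close>.\<close>
        have inv_a: "inv a = inv b \<otimes> (x \<otimes> inv (x \<otimes> x))" (is "_ = ?c")
        proof -
          have "inv b \<otimes> (x \<otimes> inv (x \<otimes> x)) = inv b \<otimes> ((x \<otimes> inv x) \<otimes> inv x)"
            using x bc by (simp only: m_assoc inv_mult_group m_closed inv_closed)
          then show ?thesis using x bc 2 by (simp add: inv_mult_group)
        qed
        have "inv b \<in> M" "inv (x \<otimes> x) \<in> M" using 2 sq[OF x(1)] by auto
        then have "?c \<in> K" unfolding K_def using M_mult_coset by blast
        with inv_a show ?thesis by metis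
      qed
    next
      fix a b assume "a \<in> K" "b \<in> K"
      then consider "a \<in> M" "b \<in> M" | d where "a \<in> M" "d \<in> M" "b = x \<otimes> d"
        | c where "c \<in> M" "a = x \<otimes> c" "b \<in> M"
        | c d where "c \<in> M" "a = x \<otimes> c" "d \<in> M" "b = x \<otimes> d"
        unfolding K_def by blast
      then show "a \<otimes> b \<in> K"
      proof cases
        case 1
        then show ?thesis by (simp add: K_def)
      next
        case 2
        then show ?thesis using M_mult_coset[of a d] by (simp add: K_def)
      next
        case 3
        then have "a \<otimes> b = x \<otimes> (c \<otimes> b)" using x by (simp add: m_assoc)
        then show ?thesis using M.m_closed[OF 3(1,3)] by (simp add: K_def)
      next
        case 4
        then have "a \<otimes> b = (x \<otimes> c \<otimes> x) \<otimes> d" using x by (simp add: m_assoc)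
        then show ?thesis using M.m_closed[OF conj[OF x(1) 4(1)] 4(3)] by (simp add: K_def)
      qed
    qed
    moreover have "M \<noteq> K"
    proof -
      have "x \<otimes> \<one> \<in> K" unfolding K_def using M.one_closed by blast
      then show ?thesis using x by auto
    qed
    ultimately have "K = carrier G"
      using max[of K] M by (auto simp: S_def K_def)
    then show ?thesis using h by (auto simp: K_def)
  qed
  \<comment> \<open>The sign character with kernel \<open>M\<close>. Of the four cases below, the
    one with both factors outside \<open>M\<close> is where index two, in the form of
    \<open>cover\<close>, enters.\<close>
  define \<chi> :: "'a \<Rightarrow> complex" where "\<chi> g = (if g \<in> M then 1 else -1)" for g
  have "\<chi> (g \<otimes> h) = \<chi> g * \<chi> h" if g: "g \<in> carrier G" and h: "h \<in> carrier G" for g h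
  proof -
    have 1: "g \<otimes> h \<in> M" if "g \<in> M" "h \<in> M" using that by simp
    have 2: "g \<otimes> h \<notin> M" if "g \<in> M" "h \<notin> M"
    proof
      assume "g \<otimes> h \<in> M"
      then have "inv g \<otimes> (g \<otimes> h) \<in> M" by (rule M.m_closed[OF M.m_inv_closed[OF that(1)]])
      moreover have "inv g \<otimes> (g \<otimes> h) = h" using g h by (simp add: m_assoc[symmetric])
      ultimately show False using that(2) by metis
    qed
    have 3: "g \<otimes> h \<notin> M" if "g \<notin> M" "h \<in> M"
    proof
      assume "g \<otimes> h \<in> M"
      then have "(g \<otimes> h) \<otimes> inv h \<in> M" by (rule M.m_closed[OF _ M.m_inv_closed[OF that(2)]])
      moreover have "(g \<otimes> h) \<otimes> inv h = g" using g h by (simp add: m_assoc)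
      ultimately show False using that(1) by metis
    qed
    have 4: "g \<otimes> h \<in> M" if "g \<notin> M" "h \<notin> M"
    proof -
      from cover[OF g that(1) h that(2)] obtain m where m: "m \<in> M" "h = g \<otimes> m" by blast
      then have "g \<otimes> h = (g \<otimes> g) \<otimes> m" using g by (simp add: m_assoc)
      then show ?thesis using sq[OF g] m by simp
    qed
    show ?thesis using 1 2 3 4 by (cases "g \<in> M"; cases "h \<in> M") (simp_all add: \<chi>_def)
  qed
  moreover have "\<chi> g \<noteq> 0" for g by (simp add: \<chi>_def)
  ultimately have "linear_character G (\<lambda>g\<in>carrier G. \<chi> g)"
    by (intro linear_characterI)
  moreover have "real_character G (\<lambda>g\<in>carrier G. \<chi> g)"
    by (auto simp: real_character_def \<chi>_def)
  moreover have "(\<lambda>g\<in>carrier G. \<chi> g) \<noteq> principal_character G"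
  proof -
    obtain x where x: "x \<in> carrier G" "x \<notin> M"
      using M M.subset by (auto simp: S_def)
    have "(\<lambda>g\<in>carrier G. \<chi> g) x \<noteq> principal_character G x"
      using x by (simp add: \<chi>_def principal_character_def)
    then show ?thesis by metis
  qed
  ultimately show ?thesis by (auto simp: R1_def)
qed

section \<open>Positivity of convolution powers\<close>

text \<open>In the order on complex numbers used here, \<open>0 \<le> z\<close> says that
  \<open>z\<close> is real and nonnegative, so the inequalities also carry realness.\<close>

lemma conv_power_nonneg:
  assumes "\<And>g. g \<in> carrier G \<Longrightarrow> 0 \<le> P g" and "h \<in> carrier G"
  shows "0 \<le> conv_power G P (Suc n) h"
  using assms(2)
proof (induction n arbitrary: h)
  case 0
  then show ?case using assms(1) by simp
next
  case (Suc n)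
  then show ?case
    by (auto simp: convolution_def assms(1) intro!: sum_nonneg mult_nonneg_nonneg)
qed

text \<open>A single summand, the one at index \<open>g\<close>, is already positive, and the others
  are nonnegative.\<close>

lemma convolution_pos:
  assumes fin: "finite (carrier G)"
    and nonneg: "\<And>g. g \<in> carrier G \<Longrightarrow> 0 \<le> A g" "\<And>g. g \<in> carrier G \<Longrightarrow> 0 \<le> B g"
    and g: "g \<in> carrier G" "A g > 0" and h: "h \<in> carrier G" "B h > 0"
  shows "convolution G A B (g \<otimes> h) > 0"
proof -
  have "0 < A g * B h"
    using g h by (auto simp: less_complex_def)
  also have "A g * B h = A g * B (inv g \<otimes> (g \<otimes> h))"
    using g h by (simp add: m_assoc[symmetric])
  also have "\<dots> \<le> convolution G A B (g \<otimes> h)"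
    unfolding convolution_def
    using assms by (intro member_le_sum) (auto intro!: mult_nonneg_nonneg)
  finally show ?thesis .
qed

text \<open>Each element is a product of generators, and \<open>sym\<close> makes inverses of
  generators points of positive mass too, so some power is positive there. Since
  \<open>P \<one> > 0\<close>, positivity persists in all later powers, and finiteness gives a
  common exponent.\<close>

lemma conv_power_pos:
  assumes fin: "finite (carrier G)"
    and nonneg: "\<And>g. g \<in> carrier G \<Longrightarrow> 0 \<le> P g" and one: "P \<one> > 0"
    and sym: "\<And>g. g \<in> carrier G \<Longrightarrow> P (inv g) = P g"
    and gen: "generate G {g \<in> carrier G. P g > 0} = carrier G"
  obtains m where "\<And>g. g \<in> carrier G \<Longrightarrow> conv_power G P (Suc m) g > 0"
proof -
  have ex: "\<exists>n. conv_power G P (Suc n) g > 0"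
    if "g \<in> generate G {g \<in> carrier G. P g > 0}" for g
    using that
  proof induction
    case one
    then show ?case using assms(3) by (intro exI[of _ 0]) simp
  next
    case (incl h)
    then show ?case by (intro exI[of _ 0]) simp
  next
    case (inv h)
    then show ?case by (intro exI[of _ 0]) (simp add: sym)
  next
    case (eng g h)
    then obtain m n where "conv_power G P (Suc m) g > 0" "conv_power G P (Suc n) h > 0" by blast
    moreover have "g \<in> carrier G" "h \<in> carrier G" using eng gen by auto
    ultimately have "conv_power G P (Suc m + Suc n) (g \<otimes> h) > 0"
      using conv_power_nonneg[OF nonneg] by (subst conv_power_add) (auto intro!: convolution_pos fin)
    then show ?case by (intro exI[of _ "m + Suc n"]) simp
  qed
  then obtain n where n: "\<And>g. g \<in> carrier G \<Longrightarrow> conv_power G P (Suc (n g)) g > 0"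
    unfolding gen by metis
  \<comment> \<open>An additional factor \<open>P\<close> can stay at \<open>\<one>\<close>, so
    supports never shrink.\<close>
  have mono: "conv_power G P (Suc (m + k)) g > 0"
    if "g \<in> carrier G" "conv_power G P (Suc m) g > 0" for g m k
  proof (induction k)
    case 0
    then show ?case using that by simp
  next
    case (Suc k)
    have "convolution G P (conv_power G P (Suc (m + k))) (\<one> \<otimes> g) > 0"
      using Suc that(1) one nonneg conv_power_nonneg[OF nonneg] by (intro convolution_pos fin) auto
    then show ?case using that(1) by simp
  qed
  \<comment> \<open>The sum of all the individual exponents serves as a common upper bound for
    them.\<close>
  have "conv_power G P (Suc (\<Sum>g\<in>carrier G. n g)) g > 0" if g: "g \<in> carrier G" for g
  proof -
    have "n g \<le> (\<Sum>g\<in>carrier G. n g)"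
      by (rule member_le_sum) (use g fin in auto)
    then show ?thesis using mono[OF g n[OF g]] by (metis le_add_diff_inverse)
  qed
  then show ?thesis by (rule that)
qed

section \<open>Contraction towards the uniform probability\<close>

text \<open>Doeblin minorisation: since \<open>F\<close> has mean zero, subtracting the constant \<open>c\<close> from \<open>Q\<close> does
  not change \<open>Q * F\<close>, but lowers the total mass of \<open>Q\<close>.\<close>

lemma convolution_contraction:
  fixes c :: real
  assumes Q: "\<And>g. g \<in> carrier G \<Longrightarrow> complex_of_real c \<le> Q g"
    and mass: "(\<Sum>g\<in>carrier G. Q g) = 1" and zero: "(\<Sum>g\<in>carrier G. F g) = 0"
  shows "(\<Sum>h\<in>carrier G. cmod (convolution G Q F h)) \<le>
    (1 - card (carrier G) * c) * (\<Sum>h\<in>carrier G. cmod (F h))"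
proof -
  \<comment> \<open>The complex order makes \<open>Q g - of_real c\<close> a nonnegative real
    number.\<close>
  have norm: "cmod (Q g - of_real c) = Re (Q g) - c" if "g \<in> carrier G" for g
    using Q[OF that] by (simp add: less_eq_complex_def cmod_eq_Re)
  have "(\<Sum>h\<in>carrier G. cmod (convolution G Q F h)) \<le>
      (\<Sum>h\<in>carrier G. \<Sum>g\<in>carrier G. (Re (Q g) - c) * cmod (F (inv g \<otimes> h)))"
  proof (rule sum_mono)
    fix h assume h: "h \<in> carrier G"
    have "(\<Sum>g\<in>carrier G. of_real c * F (inv g \<otimes> h)) = 0"
      using sum_translate_inv[OF h, of F] zero by (simp flip: sum_distrib_left)
    then have "convolution G Q F h = (\<Sum>g\<in>carrier G. (Q g - of_real c) * F (inv g \<otimes> h))"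
      by (simp add: convolution_def left_diff_distrib sum_subtractf)
    also have "cmod \<dots> \<le> (\<Sum>g\<in>carrier G. (Re (Q g) - c) * cmod (F (inv g \<otimes> h)))"
      by (rule sum_norm_le) (simp add: norm_mult norm)
    finally show "cmod (convolution G Q F h) \<le>
      (\<Sum>g\<in>carrier G. (Re (Q g) - c) * cmod (F (inv g \<otimes> h)))" .
  qed
  also have "\<dots> = (\<Sum>g\<in>carrier G. \<Sum>h\<in>carrier G. (Re (Q g) - c) * cmod (F (inv g \<otimes> h)))"
    by (rule sum.swap)
  also have "\<dots> = (\<Sum>g\<in>carrier G. (Re (Q g) - c) * (\<Sum>h\<in>carrier G. cmod (F h)))"
    using sum_translate[of "inv _" "\<lambda>h. cmod (F h)"]
    by (intro sum.cong) (auto simp flip: sum_distrib_left)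
  also have "\<dots> = (1 - card (carrier G) * c) * (\<Sum>h\<in>carrier G. cmod (F h))"
    using arg_cong[OF mass, of Re] by (simp add: sum_distrib_right[symmetric] sum_subtractf)
  finally show ?thesis .
qed

text \<open>Convolution with a function of total mass 1 fixes \<open>uniform_prob G\<close>, so the
  deviation from uniformity is itself propagated by convolution.\<close>

lemma convolution_diff_uniform:
  assumes "(\<Sum>g\<in>carrier G. Q g) = 1"
  shows "convolution G Q (\<lambda>g. B g - uniform_prob G g) h = convolution G Q B h - uniform_prob G h"
  using assms
  by (simp add: convolution_def uniform_prob_def right_diff_distrib sum_subtractf
      flip: sum_divide_distrib)

text \<open>The l1 deviation never increases, hence converges to some \<open>L\<close>. Over
  \<open>Suc m\<close> steps it shrinks by the factor \<open>1 - card (carrier G) * c\<close> with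
  \<open>c > 0\<close>; passing to the limit in this inequality forces \<open>L = 0\<close>.\<close>

lemma conv_power_tendsto_uniform:
  assumes fin: "finite (carrier G)"
    and nonneg: "\<And>g. g \<in> carrier G \<Longrightarrow> 0 \<le> P g" and mass: "(\<Sum>g\<in>carrier G. P g) = 1"
    and pos: "\<And>g. g \<in> carrier G \<Longrightarrow> conv_power G P (Suc m) g > 0"
  shows "(\<lambda>n. \<Sum>h\<in>carrier G. cmod (conv_power G P n h - uniform_prob G h)) \<longlonglongrightarrow> 0"
proof -
  \<comment> \<open>The shift by one skips the junk power at 0; \<open>LIMSEQ_imp_Suc\<close> undoes
    it at the end.\<close>
  define F where "F n h = conv_power G P (Suc n) h - uniform_prob G h" for n h
  define a where "a n = (\<Sum>h\<in>carrier G. cmod (F n h))" for n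
  have card: "card (carrier G) > 0"
    using fin one_closed card_gt_0_iff by blast
  have mass_n: "(\<Sum>h\<in>carrier G. conv_power G P (Suc n) h) = 1" for n
    using sum_character_conv_power[of "\<lambda>_. 1" P n] mass by simp
  have zero: "(\<Sum>h\<in>carrier G. F n h) = 0" for n
    using mass_n[of n] card by (simp add: F_def sum_subtractf uniform_prob_def)
  define c where "c = Min ((\<lambda>g. Re (conv_power G P (Suc m) g)) ` carrier G)"
  have c_pos: "c > 0"
    using pos fin one_closed unfolding c_def by (subst Min_gr_iff) (auto simp: less_complex_def)
  have c_le: "complex_of_real c \<le> conv_power G P (Suc m) g" if "g \<in> carrier G" for g
    using that fin pos[OF that] by (auto simp: c_def less_eq_complex_def less_complex_def)
  have a_nonneg: "0 \<le> a n" for n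
    by (simp add: a_def sum_nonneg)
  have "F (Suc n) h = convolution G P (F n) h" for n h
    using convolution_diff_uniform[OF mass] by (simp add: F_def[abs_def])
  \<comment> \<open>The contraction lemma with \<open>c = 0\<close> is plain nonexpansion.\<close>
  then have dec: "a (Suc n) \<le> a n" for n
    using convolution_contraction[of 0 P "F n"] nonneg mass zero by (simp add: a_def)
  have "F (Suc m + n) h = convolution G (conv_power G P (Suc m)) (F n) h"
    if "h \<in> carrier G" for n h
    using conv_power_add[OF that, of P m n] convolution_diff_uniform[OF mass_n[of m]]
    by (simp add: F_def[abs_def] del: conv_power.simps)
  then have contr: "a (Suc m + n) \<le> (1 - card (carrier G) * c) * a n" for n
    using convolution_contraction[OF c_le mass_n zero] by (simp add: a_def del: conv_power.simps)
  have "decseq a" using dec by (simp add: decseq_Suc_iff)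
  then obtain L where L: "a \<longlonglongrightarrow> L"
    using decseq_convergent[of a 0] a_nonneg by blast
  have "(\<lambda>n. a (n + Suc m)) \<longlonglongrightarrow> L"
    by (rule LIMSEQ_ignore_initial_segment[OF L])
  moreover have "(\<lambda>n. (1 - card (carrier G) * c) * a n) \<longlonglongrightarrow> (1 - card (carrier G) * c) * L"
    by (intro tendsto_intros L)
  ultimately have "L \<le> (1 - card (carrier G) * c) * L"
    by (rule LIMSEQ_le) (use contr in \<open>auto simp: add.commute\<close>)
  then have "(card (carrier G) * c) * L \<le> 0" by (simp add: algebra_simps)
  then have "L \<le> 0" using c_pos card by (simp add: mult_le_0_iff)
  moreover have "0 \<le> L" by (rule LIMSEQ_le_const[OF L]) (use a_nonneg in auto)
  ultimately have "a \<longlonglongrightarrow> 0" using L by simp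
  then show ?thesis
    unfolding a_def F_def by (rule LIMSEQ_imp_Suc)
qed

end

section \<open>Comparison of \<open>function_norm\<close> with the l1 norm\<close>

lemma cmod_le_function_norm:
  assumes "finite (carrier G)" "g \<in> carrier G"
  shows "cmod (F g) \<le> sqrt (card (carrier G)) * function_norm G F"
proof -
  have card: "card (carrier G) > 0"
    using assms card_gt_0_iff by blast
  have "(cmod (F g))\<^sup>2 \<le> (\<Sum>g\<in>carrier G. (cmod (F g))\<^sup>2)"
    using assms by (intro member_le_sum) auto
  then have "cmod (F g) \<le> sqrt (\<Sum>g\<in>carrier G. (cmod (F g))\<^sup>2)"
    by (rule real_le_rsqrt)
  then show ?thesis
    using card by (simp add: function_norm_eq flip: real_sqrt_mult)
qed

lemma function_norm_le:
  assumes "finite (carrier G)"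
  shows "function_norm G F \<le> (\<Sum>g\<in>carrier G. cmod (F g))"
proof (cases "carrier G = {}")
  case False
  then have card: "card (carrier G) > 0"
    using assms card_gt_0_iff by blast
  have "(\<Sum>g\<in>carrier G. (cmod (F g))\<^sup>2) / card (carrier G) \<le> (\<Sum>g\<in>carrier G. (cmod (F g))\<^sup>2)"
    using card divide_left_mono[of 1 "card (carrier G)" "\<Sum>g\<in>carrier G. (cmod (F g))\<^sup>2"]
    by (simp add: sum_nonneg)
  also have "\<dots> \<le> (\<Sum>g\<in>carrier G. cmod (F g))\<^sup>2"
  proof -
    have "cmod (F g) * cmod (F g) \<le> cmod (F g) * (\<Sum>g\<in>carrier G. cmod (F g))"
      if "g \<in> carrier G" for g
      using member_le_sum[OF that, of "\<lambda>g. cmod (F g)"] assms by (simp add: mult_left_mono)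
    then show ?thesis
      unfolding power2_eq_square by (subst sum_distrib_right) (rule sum_mono)
  qed
  finally show ?thesis
    by (simp add: function_norm_eq real_le_lsqrt sum_nonneg)
qed (simp add: function_norm_eq)

text \<open>On a fixed finite group the two norms bound each other up to constants. This moves the
  problem to the l1 norm, in which both the contraction and the obstruction by characters are
  expressed.\<close>

lemma function_norm_tendsto_zero_iff:
  assumes "finite (carrier G)"
  shows "(\<lambda>n. function_norm G (F n)) \<longlonglongrightarrow> 0 \<longleftrightarrow> (\<lambda>n. \<Sum>g\<in>carrier G. cmod (F n g)) \<longlonglongrightarrow> 0"
proof
  assume "(\<lambda>n. function_norm G (F n)) \<longlonglongrightarrow> 0"
  then have lim: "(\<lambda>n. sqrt (card (carrier G)) * function_norm G (F n)) \<longlonglongrightarrow> 0"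
    by (rule tendsto_mult_right_zero)
  have "(\<lambda>n. cmod (F n g)) \<longlonglongrightarrow> 0" if "g \<in> carrier G" for g
    by (rule tendsto_sandwich[OF _ _ tendsto_const lim])
      (simp_all add: cmod_le_function_norm[OF assms that])
  then show "(\<lambda>n. \<Sum>g\<in>carrier G. cmod (F n g)) \<longlonglongrightarrow> 0"
    using tendsto_sum[of "carrier G" "\<lambda>g n. cmod (F n g)" "\<lambda>_. 0"] by simp
next
  assume lim: "(\<lambda>n. \<Sum>g\<in>carrier G. cmod (F n g)) \<longlonglongrightarrow> 0"
  have "0 \<le> function_norm G (F n)" for n
    by (simp add: function_norm_eq sum_nonneg)
  then show "(\<lambda>n. function_norm G (F n)) \<longlonglongrightarrow> 0"
    by (intro tendsto_sandwich[OF _ _ tendsto_const lim]) (simp_all add: function_norm_le[OF assms])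
qed

section \<open>The equivalence for the distribution of squares\<close>

theorem mainTheorem2:
  fixes G :: "('a, 'b) monoid_scheme"
  assumes "group G" and "finite (carrier G)"
  shows "((\<lambda>n. function_norm G (\<lambda>g. conv_power G (square_prob G) n g - uniform_prob G g))
            \<longlonglongrightarrow> 0)
         \<longleftrightarrow> R1 G = {}"
proof -
  interpret group G by fact
  have card: "card (carrier G) > 0"
    using assms(2) one_closed card_gt_0_iff by blast
  let ?D = "\<lambda>n g. conv_power G (square_prob G) n g - uniform_prob G g"
  have "(\<lambda>n. \<Sum>g\<in>carrier G. cmod (?D n g)) \<longlonglongrightarrow> 0 \<longleftrightarrow> R1 G = {}"
  proof
    assume lim: "(\<lambda>n. \<Sum>g\<in>carrier G. cmod (?D n g)) \<longlonglongrightarrow> 0"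
    show "R1 G = {}"
    proof (rule ccontr)
      assume "R1 G \<noteq> {}"
      then obtain \<chi> where lin: "linear_character G \<chi>" and real: "real_character G \<chi>"
        and nonprincipal: "\<chi> \<noteq> principal_character G"
        by (auto simp: R1_def)
      note mult = linear_character_mult[OF lin is_monoid]
      note square = real_linear_character_square[OF assms(2) lin real]
      have "\<exists>x\<in>carrier G. \<chi> x \<noteq> 1"
      proof (rule ccontr)
        assume one: "\<not> ?thesis"
        \<comment> \<open>Extensionality upgrades equality with 1 on the carrier to equality of HOL
          functions.\<close>
        have "\<chi> \<in> extensional (carrier G)"
          using lin unfolding linear_character_def character_of_degree_def by auto
        then have "\<chi> = principal_character G"
          using one unfolding principal_character_def
          by (intro extensionalityI[of \<chi> "carrier G"]) auto
        with nonprincipal show False ..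
      qed
      then have zero: "(\<Sum>g\<in>carrier G. \<chi> g) = 0"
        using character_sum_zero[of \<chi>] mult by blast
      have one: "(\<Sum>g\<in>carrier G. \<chi> g * square_prob G g) = 1"
        using sum_character_square_prob[OF assms(2) mult] square card by simp
      \<comment> \<open>Pairing the deviation with \<open>\<chi>\<close> gives exactly 1 for every
        power, and the values of \<open>\<chi>\<close> have modulus 1, so the l1 deviation cannot
        drop below 1.\<close>
      have "1 \<le> (\<Sum>g\<in>carrier G. cmod (?D (Suc n) g))" for n
      proof -
        have "(\<Sum>g\<in>carrier G. \<chi> g * ?D (Suc n) g) = 1"
          using sum_character_conv_power[OF mult, of "square_prob G" n] one zero
          by (simp add: right_diff_distrib sum_subtractf uniform_prob_def
              flip: sum_divide_distrib del: conv_power.simps)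
        then have "1 = cmod (\<Sum>g\<in>carrier G. \<chi> g * ?D (Suc n) g)"
          by (simp only: norm_one)
        also have "\<dots> \<le> (\<Sum>g\<in>carrier G. cmod (?D (Suc n) g))"
        proof (rule sum_norm_le)
          fix g assume "g \<in> carrier G"
          then have "\<chi> g = 1 \<or> \<chi> g = -1" using square by (simp add: power2_eq_1_iff)
          then show "cmod (\<chi> g * ?D (Suc n) g) \<le> cmod (?D (Suc n) g)"
            by (auto simp: norm_mult)
        qed
        finally show ?thesis .
      qed
      then have "1 \<le> (0::real)"
        using LIMSEQ_le_const[OF LIMSEQ_Suc[OF lim]] by blast
      then show False by simp
    qed
  next
    assume R1: "R1 G = {}"
    have nonneg: "0 \<le> square_prob G g" for g
      by (simp add: square_prob_def less_eq_complex_def)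
    have pos: "square_prob G g > 0 \<longleftrightarrow> (\<exists>h\<in>carrier G. g = h \<otimes>\<^bsub>G\<^esub> h)" for g
    proof -
      have "square_prob G g > 0 \<longleftrightarrow> root_count G g > 0"
        using card by (simp add: square_prob_def less_complex_def zero_less_divide_iff)
      also have "\<dots> \<longleftrightarrow> (\<exists>h\<in>carrier G. g = h \<otimes>\<^bsub>G\<^esub> h)"
        using assms(2) by (auto simp: root_count_def card_gt_0_iff numeral_2_eq_2)
      finally show ?thesis .
    qed
    have "{g \<in> carrier G. square_prob G g > 0} = (\<lambda>h. h \<otimes>\<^bsub>G\<^esub> h) ` carrier G"
      by (auto simp: pos)
    then have gen: "generate G {g \<in> carrier G. square_prob G g > 0} = carrier G"
      using R1_nonempty[OF assms(2)] R1 by auto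
    have one: "square_prob G \<one>\<^bsub>G\<^esub> > 0"
      unfolding pos by (intro bexI[of _ "\<one>\<^bsub>G\<^esub>"]) auto
    \<comment> \<open>Inversion is a bijection between the square roots of \<open>g\<close> and
      those of its inverse.\<close>
    have sym: "square_prob G (inv\<^bsub>G\<^esub> g) = square_prob G g" if "g \<in> carrier G" for g
    proof -
      have "root_count G (inv\<^bsub>G\<^esub> g) = root_count G g"
        unfolding root_count_def
        by (rule bij_betw_same_card[of "m_inv G"], rule bij_betw_byWitness[of _ "m_inv G"])
          (use that in \<open>auto simp: nat_pow_inv\<close>)
      then show ?thesis by (simp add: square_prob_def)
    qed
    \<comment> \<open>The total mass is the sum against the constant multiplicative function
      1.\<close>
    have mass: "(\<Sum>g\<in>carrier G. square_prob G g) = 1"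
      using sum_character_square_prob[OF assms(2), of "\<lambda>_. 1"] card by simp
    obtain m where "\<And>g. g \<in> carrier G \<Longrightarrow> conv_power G (square_prob G) (Suc m) g > 0"
      using conv_power_pos[OF assms(2) nonneg one sym gen] by blast
    then show "(\<lambda>n. \<Sum>g\<in>carrier G. cmod (?D n g)) \<longlonglongrightarrow> 0"
      using conv_power_tendsto_uniform[OF assms(2) nonneg mass] by blast
  qed
  then show ?thesis
    using function_norm_tendsto_zero_iff[OF assms(2), of ?D] by simp
qed

end
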